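(* Let $n \geq 0$ and $m \geq 1$ be integers, and let $a_1,\ldots,a_n$ and $b_1,\ldots,b_m$ be positive integers. Then there exists an upho poset $P$ whose rank-generating function is $$F_P(x)=\frac{(1+a_1x)(1+a_2x)\cdots(1+a_nx)}{(1-b_1x)(1-b_2x)\cdots(1-b_mx)}.$$
   Context: A poset $P$ is ranked if it has a disjoint decomposition $P=P_0\sqcup P_1\sqcup P_2\sqcup\cdots$ such that whenever $x\in P_i$ and $y$ covers $x$, then $y\in P_{i+1}$. It is of finite type if every $P_i$ is finite. Its rank-generating function is $F_P(x)=\sum_{k\ge 0}|P_k|x^k$. For $s\in P$, the principal order filter is $V_{P,s}=\{t\in P: t\ge s\}$. A ranked poset $P$ is upho (upper homogeneous finite) if it is of finite type and $V_{P,s}\cong P$ (as posets) for every $s\in P$. *)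

theory Defs
  imports
    "HOL-Computational_Algebra.Formal_Power_Series"
    "HOL-Library.Disjoint_Sets"
begin

text \<open>
  A poset is a carrier set \<open>A\<close> with a relation \<open>r\<close> such that \<^term>\<open>partial_order_on A r\<close>;
  \<open>(x, y) \<in> r\<close> means \<open>x \<le> y\<close>.
\<close>

definition covers :: "'a rel \<Rightarrow> 'a \<Rightarrow> 'a \<Rightarrow> bool" where
  "covers r y x \<longleftrightarrow> (x, y) \<in> r \<and> x \<noteq> y \<and> (\<forall>z. (x, z) \<in> r \<and> (z, y) \<in> r \<longrightarrow> z = x \<or> z = y)"

definition ranked_poset :: "'a set \<Rightarrow> 'a rel \<Rightarrow> (nat \<Rightarrow> 'a set) \<Rightarrow> bool" where
  "ranked_poset A r R \<longleftrightarrow>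
     partial_order_on A r \<and>
     (\<Union>i. R i) = A \<and> disjoint_family R \<and>
     (\<forall>i x y. x \<in> R i \<and> covers r y x \<longrightarrow> y \<in> R (Suc i))"

definition finite_type :: "(nat \<Rightarrow> 'a set) \<Rightarrow> bool" where
  "finite_type R \<longleftrightarrow> (\<forall>i. finite (R i))"

definition locally_finite_poset :: "'a set \<Rightarrow> 'a rel \<Rightarrow> bool" where
  "locally_finite_poset A r \<longleftrightarrow> (\<forall>x\<in>A. \<forall>y\<in>A. finite {z \<in> A. (x, z) \<in> r \<and> (z, y) \<in> r})"

definition principal_filter :: "'a set \<Rightarrow> 'a rel \<Rightarrow> 'a \<Rightarrow> 'a set" where
  "principal_filter A r s = {t \<in> A. (s, t) \<in> r}"

definition poset_isomorphic :: "'a set \<Rightarrow> 'a rel \<Rightarrow> 'b set \<Rightarrow> 'b rel \<Rightarrow> bool" where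
  "poset_isomorphic A r B q \<longleftrightarrow>
     (\<exists>f. bij_betw f A B \<and> (\<forall>x\<in>A. \<forall>y\<in>A. (x, y) \<in> r \<longleftrightarrow> (f x, f y) \<in> q))"

text \<open>
  Local finiteness is the usual standing convention for ranked posets and must be explicit here:
  the rank condition constrains only covering pairs, so a dense order such as the nonnegative
  rationals, which has no covering pairs, would otherwise be upho with respect to every
  partition into finite sets.  By \<open>ranked_poset_strict_mono\<close> below, local finiteness makes
  the rank strictly increasing.
\<close>

definition upho :: "'a set \<Rightarrow> 'a rel \<Rightarrow> (nat \<Rightarrow> 'a set) \<Rightarrow> bool" where
  "upho A r R \<longleftrightarrow>
     ranked_poset A r R \<and> locally_finite_poset A r \<and> finite_type R \<and>
     (\<forall>s\<in>A. poset_isomorphic (principal_filter A r s)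
               (r \<inter> principal_filter A r s \<times> principal_filter A r s) A r)"

definition rank_gen_fun :: "(nat \<Rightarrow> 'a set) \<Rightarrow> rat fps" where
  "rank_gen_fun R = Abs_fps (\<lambda>k. of_nat (card (R k)))"

lemma ranked_poset_strict_mono:
  assumes "ranked_poset A r R" "locally_finite_poset A r"
    and "(x, y) \<in> r" "x \<noteq> y" "x \<in> R i" "y \<in> R j"
  shows "i < j"
  using assms(3-6)
proof (induction "card {z \<in> A. (x, z) \<in> r \<and> (z, y) \<in> r}" arbitrary: x y i j rule: less_induct)
  case less
  let ?I = "\<lambda>x y. {z \<in> A. (x, z) \<in> r \<and> (z, y) \<in> r}"
  have po: "partial_order_on A r" and U: "(\<Union>i. R i) = A"
    and disj: "disjoint_family R"
    and cov: "\<And>i x y. x \<in> R i \<Longrightarrow> covers r y x \<Longrightarrow> y \<in> R (Suc i)"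
    using assms(1) unfolding ranked_poset_def by blast+
  have rA: "r \<subseteq> A \<times> A" and refl: "\<And>a. a \<in> A \<Longrightarrow> (a, a) \<in> r"
    and "trans r" "antisym r"
    using po unfolding partial_order_on_def preorder_on_def refl_on_def by blast+
  then have tr: "\<And>a b c. (a, b) \<in> r \<Longrightarrow> (b, c) \<in> r \<Longrightarrow> (a, c) \<in> r"
    and anti: "\<And>a b. (a, b) \<in> r \<Longrightarrow> (b, a) \<in> r \<Longrightarrow> a = b"
    by (meson transD, meson antisymD)
  have xy: "x \<in> A" "y \<in> A" using less.prems rA by auto
  have fin: "finite (?I x y)" using assms(2) xy by (auto simp: locally_finite_poset_def)
  show ?case
  proof (cases "covers r y x")
    case True
    with cov less.prems have "y \<in> R (Suc i)" by blast
    with disj less.prems(4) have "j = Suc i" by (auto simp: disjoint_family_on_def)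
    then show ?thesis by simp
  next
    case False
    then obtain z where z: "(x, z) \<in> r" "(z, y) \<in> r" "z \<noteq> x" "z \<noteq> y"
      using less.prems unfolding covers_def by blast
    then have "z \<in> A" using rA by auto
    then obtain k where k: "z \<in> R k" using U by blast
    have "?I x z \<subset> ?I x y"
    proof
      show "?I x z \<subseteq> ?I x y" using z tr by blast
      have "y \<in> ?I x y" "y \<notin> ?I x z" using less.prems xy refl anti[of y z] z by blast+
      then show "?I x z \<noteq> ?I x y" by blast
    qed
    moreover have "?I z y \<subset> ?I x y"
    proof
      show "?I z y \<subseteq> ?I x y" using z tr by blast
      have "x \<in> ?I x y" "x \<notin> ?I z y" using less.prems xy refl anti[of x z] z by blast+
      then show "?I z y \<noteq> ?I x y" by blast
    qed
    ultimately have "card (?I x z) < card (?I x y)" "card (?I z y) < card (?I x y)"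
      using fin psubset_card_mono by blast+
    then have "i < k" "k < j"
      using less.hyps[of x z i k] less.hyps[of z y k j] less.prems z k by simp_all
    then show ?thesis by simp
  qed
qed

end

theory Submission
  imports Defs "HOL-Library.Countable" "HOL-Algebra.Divisibility" "HOL-Algebra.Weak_Morphisms"
begin

unbundle fps_syntax

text \<open>
  A left-cancellative graded monoid \<open>G\<close> that is generated in degree one and has finitely many
  elements in each degree is upho under left divisibility, because \<open>z \<mapsto> s z\<close> is an isomorphism
  onto the filter of \<open>s\<close>.  So it suffices to realise the series as the growth series of such a
  monoid.  A direct product of free monoids yields the denominator.  To multiply the series by
  \<open>1 + a X\<close>, fix an element \<open>x\<close> of degree one in \<open>G\<close> and adjoin new generators
  \<open>y\<^sub>1, \<dots>, y\<^sub>a\<close> subject to \<open>y\<^sub>i v = x v\<close> for all \<open>v \<noteq> 1\<close>: the elements of the new monoid are \<open>m\<close> and \<open>m y\<^sub>i\<close> with \<open>m \<in> G\<close>.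
\<close>

section \<open>Left divisibility in graded monoids\<close>

definition level :: "('a, 'b) monoid_scheme \<Rightarrow> ('a \<Rightarrow> nat) \<Rightarrow> nat \<Rightarrow> 'a set" where
  "level G deg k = {x \<in> carrier G. deg x = k}"

definition growth_series :: "('a, 'b) monoid_scheme \<Rightarrow> ('a \<Rightarrow> nat) \<Rightarrow> rat fps" where
  "growth_series G deg = rank_gen_fun (level G deg)"

lemma growth_series_nth [simp]: "growth_series G deg $ k = of_nat (card (level G deg k))"
  by (simp add: growth_series_def rank_gen_fun_def)

definition left_divisibility :: "('a, 'b) monoid_scheme \<Rightarrow> 'a rel" where
  "left_divisibility G = {(x, y). x \<in> carrier G \<and> y \<in> carrier G \<and> x divides\<^bsub>G\<^esub> y}"

lemma poset_isomorphic_sym: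
  assumes "poset_isomorphic A r B q"
  shows "poset_isomorphic B q A r"
proof -
  obtain f where bij: "bij_betw f A B"
    and mono: "\<And>x y. x \<in> A \<Longrightarrow> y \<in> A \<Longrightarrow> (x, y) \<in> r \<longleftrightarrow> (f x, f y) \<in> q"
    using assms by (auto simp: poset_isomorphic_def)
  let ?g = "inv_into A f"
  have "bij_betw ?g B A"
    using bij by (rule bij_betw_inv_into)
  moreover have "(x, y) \<in> q \<longleftrightarrow> (?g x, ?g y) \<in> r" if "x \<in> B" "y \<in> B" for x y
    using that mono[of "?g x" "?g y"] bij
    by (simp add: bij_betw_imp_surj_on bij_betw_inv_into_right inv_into_into)
  ultimately show ?thesis
    unfolding poset_isomorphic_def by blast
qed

context monoid
begin

lemma divides_mult_l_iff:
  assumes "inj_on ((\<otimes>) s) (carrier G)" "s \<in> carrier G" "x \<in> carrier G" "y \<in> carrier G"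
  shows "s \<otimes> x divides s \<otimes> y \<longleftrightarrow> x divides y"
proof
  assume "s \<otimes> x divides s \<otimes> y"
  then obtain z where z: "z \<in> carrier G" "s \<otimes> y = s \<otimes> (x \<otimes> z)"
    using assms by (auto simp: m_assoc)
  then have "y = x \<otimes> z"
    using assms by (simp add: inj_on_eq_iff)
  then show "x divides y"
    using z by blast
qed (use assms in blast)

lemma principal_filter_left_divisibility:
  assumes "s \<in> carrier G"
  shows "principal_filter (carrier G) (left_divisibility G) s = (\<otimes>) s ` carrier G"
  using assms by (auto simp: principal_filter_def left_divisibility_def)

lemma principal_filter_isomorphic:
  assumes s: "s \<in> carrier G" and inj: "inj_on ((\<otimes>) s) (carrier G)"
  defines "V \<equiv> principal_filter (carrier G) (left_divisibility G) s"
  shows "poset_isomorphic V (left_divisibility G \<inter> V \<times> V) (carrier G) (left_divisibility G)"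
proof (rule poset_isomorphic_sym)
  have V: "V = (\<otimes>) s ` carrier G"
    unfolding V_def using s by (rule principal_filter_left_divisibility)
  have "(x, y) \<in> left_divisibility G \<longleftrightarrow> (s \<otimes> x, s \<otimes> y) \<in> left_divisibility G \<inter> V \<times> V"
    if "x \<in> carrier G" "y \<in> carrier G" for x y
    using that s inj by (simp add: V left_divisibility_def divides_mult_l_iff)
  moreover have "bij_betw ((\<otimes>) s) (carrier G) V"
    using inj by (simp add: V bij_betw_def)
  ultimately show "poset_isomorphic (carrier G) (left_divisibility G) V (left_divisibility G \<inter> V \<times> V)"
    unfolding poset_isomorphic_def by blast
qed

end

locale graded_monoid = monoid G for G (structure) +
  fixes deg :: "'a \<Rightarrow> nat"
  assumes deg_mult [simp]: "x \<in> carrier G \<Longrightarrow> y \<in> carrier G \<Longrightarrow> deg (x \<otimes> y) = deg x + deg y"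
    and deg_0_imp_one: "x \<in> carrier G \<Longrightarrow> deg x = 0 \<Longrightarrow> x = \<one>"
    and finite_level: "finite (level G deg k)"
begin

lemma deg_one [simp]: "deg \<one> = 0"
  using deg_mult[of \<one> \<one>] by simp

lemma deg_0_iff: "x \<in> carrier G \<Longrightarrow> deg x = 0 \<longleftrightarrow> x = \<one>"
  using deg_0_imp_one by auto

lemma mult_eq_one_imp_right_one:
  assumes "x \<in> carrier G" "y \<in> carrier G" "x \<otimes> y = \<one>"
  shows "y = \<one>"
  using assms deg_mult[of x y] by (simp add: deg_0_imp_one)

lemma divides_antisym:
  assumes "x \<in> carrier G" "x divides y" "y divides x"
  shows "x = y"
proof -
  obtain z w where z: "z \<in> carrier G" "y = x \<otimes> z" and w: "w \<in> carrier G" "x = y \<otimes> w"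
    using assms by blast
  then have "deg y = deg x + deg z" "deg x = deg y + deg w"
    using assms(1) deg_mult m_closed by metis+
  then have "z = \<one>"
    using z(1) by (simp add: deg_0_imp_one)
  then show "x = y"
    using assms(1) z(2) by simp
qed

lemma partial_order_left_divisibility: "partial_order_on (carrier G) (left_divisibility G)"
  unfolding partial_order_on_def preorder_on_def
proof (intro conjI)
  show "trans (left_divisibility G)"
    by (rule transI) (auto simp: left_divisibility_def intro: divides_trans)
  show "antisym (left_divisibility G)"
    by (rule antisymI) (auto simp: left_divisibility_def intro: divides_antisym)
qed (auto simp: left_divisibility_def refl_on_def)

lemma locally_finite_left_divisibility: "locally_finite_poset (carrier G) (left_divisibility G)"
  unfolding locally_finite_poset_def
proof (intro ballI)
  fix x y
  have "{z \<in> carrier G. (x, z) \<in> left_divisibility G \<and> (z, y) \<in> left_divisibility G}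
      \<subseteq> (\<Union>k\<le>deg y. level G deg k)"
    by (auto simp: left_divisibility_def level_def)
  then show "finite {z \<in> carrier G. (x, z) \<in> left_divisibility G \<and> (z, y) \<in> left_divisibility G}"
    by (rule finite_subset) (simp add: finite_level)
qed

end

locale upho_monoid = graded_monoid +
  assumes l_cancel:
      "c \<otimes> a = c \<otimes> b \<Longrightarrow> a \<in> carrier G \<Longrightarrow> b \<in> carrier G \<Longrightarrow> c \<in> carrier G \<Longrightarrow> a = b"
    and generated_in_degree_1:
      "x \<in> level G deg (Suc k) \<Longrightarrow> \<exists>y\<in>level G deg k. \<exists>z\<in>level G deg 1. x = y \<otimes> z"
begin

lemma deg_covers_left_divisibility:
  assumes "covers (left_divisibility G) y x"
  shows "deg y = Suc (deg x)"
proof -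
  obtain z where x: "x \<in> carrier G" and z: "z \<in> carrier G" and y: "y = x \<otimes> z" and "x \<noteq> y"
    using assms by (auto simp: covers_def left_divisibility_def)
  then have "deg z \<noteq> 0"
    by (auto simp: deg_0_iff)
  then obtain k where "z \<in> level G deg (Suc k)"
    using z by (auto simp: level_def gr0_conv_Suc)
  then obtain u v where uv: "u \<in> carrier G" "deg u = k" "v \<in> carrier G" "deg v = 1" "z = u \<otimes> v"
    using generated_in_degree_1[of z k] by (auto simp: level_def)
  then have "x divides x \<otimes> u" "x \<otimes> u divides y"
    using x y by (auto simp: m_assoc[symmetric])
  then have "x \<otimes> u = x \<or> x \<otimes> u = y"
    using assms x z y uv by (auto simp: covers_def left_divisibility_def)
  then have "deg (x \<otimes> u) = deg x \<or> deg (x \<otimes> u) = deg y"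
    by auto
  then show ?thesis
    using x y uv by auto
qed

theorem upho_left_divisibility: "upho (carrier G) (left_divisibility G) (level G deg)"
proof -
  have "ranked_poset (carrier G) (left_divisibility G) (level G deg)"
    unfolding ranked_poset_def
  proof (intro conjI allI impI)
    show "(\<Union>i. level G deg i) = carrier G" "disjoint_family (level G deg)"
      by (auto simp: level_def disjoint_family_on_def)
    fix i x y assume "x \<in> level G deg i \<and> covers (left_divisibility G) y x"
    then show "y \<in> level G deg (Suc i)"
      using deg_covers_left_divisibility by (auto simp: level_def covers_def left_divisibility_def)
  qed (rule partial_order_left_divisibility)
  moreover have "inj_on ((\<otimes>) s) (carrier G)" if "s \<in> carrier G" for s
    using that l_cancel by (auto intro: inj_onI)
  ultimately show ?thesis
    by (simp add: upho_def finite_type_def finite_level locally_finite_left_divisibility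
        principal_filter_isomorphic)
qed

end


section \<open>Direct products and free monoids\<close>

lemma level_DirProd:
  "level (G \<times>\<times> H) (\<lambda>(x, y). d x + e y) k = (\<Union>i\<in>{0..k}. level G d i \<times> level H e (k - i))"
  by (auto simp: level_def)

lemma graded_monoid_DirProd:
  assumes "graded_monoid G d" "graded_monoid H e"
  shows "graded_monoid (G \<times>\<times> H) (\<lambda>(x, y). d x + e y)"
proof -
  interpret G: graded_monoid G d by fact
  interpret H: graded_monoid H e by fact
  interpret GH: monoid "G \<times>\<times> H"
    by (rule DirProd_monoid) unfold_locales
  show ?thesis
    by unfold_locales
      (auto simp: level_DirProd G.finite_level H.finite_level G.deg_0_imp_one H.deg_0_imp_one)
qed

lemma upho_monoid_DirProd:
  assumes "upho_monoid G d" "upho_monoid H e"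
  shows "upho_monoid (G \<times>\<times> H) (\<lambda>(x, y). d x + e y)"
proof -
  interpret G: upho_monoid G d by fact
  interpret H: upho_monoid H e by fact
  let ?deg = "\<lambda>(x, y). d x + e y"
  interpret GH: graded_monoid "G \<times>\<times> H" ?deg
    by (rule graded_monoid_DirProd) unfold_locales
  show ?thesis
  proof
    fix a b c
    assume "c \<otimes>\<^bsub>G \<times>\<times> H\<^esub> a = c \<otimes>\<^bsub>G \<times>\<times> H\<^esub> b" "a \<in> carrier (G \<times>\<times> H)" "b \<in> carrier (G \<times>\<times> H)"
      "c \<in> carrier (G \<times>\<times> H)"
    then show "a = b"
      by (auto simp: mult_DirProd' dest: G.l_cancel H.l_cancel)
  next
    fix p k
    assume "p \<in> level (G \<times>\<times> H) ?deg (Suc k)"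
    then obtain x y where p: "p = (x, y)" and x: "x \<in> carrier G" and y: "y \<in> carrier H"
      and deg: "d x + e y = Suc k"
      by (auto simp: level_def)
    show "\<exists>q\<in>level (G \<times>\<times> H) ?deg k. \<exists>r\<in>level (G \<times>\<times> H) ?deg 1. p = q \<otimes>\<^bsub>G \<times>\<times> H\<^esub> r"
    proof (cases "e y")
      case 0
      then obtain u v where "u \<in> level G d k" "v \<in> level G d 1" "x = u \<otimes>\<^bsub>G\<^esub> v"
        using G.generated_in_degree_1[of x k] x deg by (auto simp: level_def)
      then show ?thesis
        using p y 0
        by (intro bexI[of _ "(u, \<one>\<^bsub>H\<^esub>)"] bexI[of _ "(v, \<one>\<^bsub>H\<^esub>)"])
          (auto simp: level_def H.deg_0_iff)
    next
      case (Suc j)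
      then obtain u v where "u \<in> level H e j" "v \<in> level H e 1" "y = u \<otimes>\<^bsub>H\<^esub> v"
        using H.generated_in_degree_1[of y j] y by (auto simp: level_def)
      then show ?thesis
        using p x deg Suc
        by (intro bexI[of _ "(x, u)"] bexI[of _ "(\<one>\<^bsub>G\<^esub>, v)"]) (auto simp: level_def)
    qed
  qed
qed

lemma growth_series_DirProd:
  assumes "graded_monoid G d" "graded_monoid H e"
  shows "growth_series (G \<times>\<times> H) (\<lambda>(x, y). d x + e y) = growth_series G d * growth_series H e"
proof (rule fps_ext)
  fix k
  have "card (level (G \<times>\<times> H) (\<lambda>(x, y). d x + e y) k)
      = (\<Sum>i=0..k. card (level G d i \<times> level H e (k - i)))"
    unfolding level_DirProd using assms[THEN graded_monoid.finite_level]
    by (intro card_UN_disjoint) (auto simp: level_def)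
  then show "growth_series (G \<times>\<times> H) (\<lambda>(x, y). d x + e y) $ k
      = (growth_series G d * growth_series H e) $ k"
    by (simp add: fps_mult_nth card_cartesian_product)
qed

definition free_monoid :: "'a set \<Rightarrow> 'a list monoid" where
  "free_monoid A = \<lparr>carrier = lists A, mult = (@), one = []\<rparr>"

lemma level_free_monoid: "level (free_monoid A) length k = {w. set w \<subseteq> A \<and> length w = k}"
  by (auto simp: level_def free_monoid_def)

lemma upho_monoid_free_monoid:
  assumes "finite A"
  shows "upho_monoid (free_monoid A) length"
proof unfold_locales
  fix w k assume "w \<in> level (free_monoid A) length (Suc k)"
  then show "\<exists>u\<in>level (free_monoid A) length k. \<exists>v\<in>level (free_monoid A) length 1.
      w = u \<otimes>\<^bsub>free_monoid A\<^esub> v"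
    by (cases w rule: rev_cases) (auto simp: level_def free_monoid_def intro!: bexI[of _ "[_]"])
qed (auto simp: level_free_monoid finite_lists_length_eq[OF assms], auto simp: free_monoid_def)

lemma growth_series_free_monoid:
  assumes "finite A"
  shows "growth_series (free_monoid A) length = inverse (1 - fps_const (of_nat (card A)) * fps_X)"
  using one_minus_const_fps_X_neg_power'[of 1 "of_nat (card A) :: rat"]
  by (intro fps_ext) (simp add: level_free_monoid card_lists_length_eq[OF assms])


section \<open>Adjoining twins of a generator\<close>

text \<open>
  The pair \<open>(m, None)\<close> encodes \<open>m\<close>, and \<open>(m, Some i)\<close> encodes \<open>m y\<^sub>i\<close>.  The retraction
  sends every \<open>y\<^sub>i\<close> to \<open>x\<close>.
\<close>

definition retract_twins ::
    "('a, 'c) monoid_scheme \<Rightarrow> 'a \<Rightarrow> 'a \<times> 'i option \<Rightarrow> 'a" where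
  "retract_twins G x = (\<lambda>(m, i). case i of None \<Rightarrow> m | Some _ \<Rightarrow> m \<otimes>\<^bsub>G\<^esub> x)"

definition adjoin_twins ::
    "('a, 'c) monoid_scheme \<Rightarrow> 'a \<Rightarrow> 'i set \<Rightarrow> ('a \<times> 'i option) monoid" where
  "adjoin_twins G x I =
    \<lparr>carrier = carrier G \<times> insert None (Some ` I),
     mult = (\<lambda>u v. if v = (\<one>\<^bsub>G\<^esub>, None) then u else (retract_twins G x u \<otimes>\<^bsub>G\<^esub> fst v, snd v)),
     one = (\<one>\<^bsub>G\<^esub>, None)\<rparr>"

lemma retract_twins_simps [simp]:
  "retract_twins G x (m, None) = m"
  "retract_twins G x (m, Some i) = m \<otimes>\<^bsub>G\<^esub> x"
  by (simp_all add: retract_twins_def)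

lemma carrier_adjoin_twins [simp]:
  "carrier (adjoin_twins G x I) = carrier G \<times> insert None (Some ` I)"
  by (simp add: adjoin_twins_def)

lemma one_adjoin_twins [simp]: "\<one>\<^bsub>adjoin_twins G x I\<^esub> = (\<one>\<^bsub>G\<^esub>, None)"
  by (simp add: adjoin_twins_def)

lemma mult_adjoin_twins:
  "u \<otimes>\<^bsub>adjoin_twins G x I\<^esub> v
    = (if v = (\<one>\<^bsub>G\<^esub>, None) then u else (retract_twins G x u \<otimes>\<^bsub>G\<^esub> fst v, snd v))"
  by (simp add: adjoin_twins_def)

context graded_monoid
begin

context
  fixes x :: 'a and I :: "'i set"
  assumes x_closed [simp]: "x \<in> carrier G" and deg_x [simp]: "deg x = 1"
begin

private abbreviation (input) "M \<equiv> adjoin_twins G x I"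
private abbreviation (input) "\<phi> \<equiv> retract_twins G x"

lemma retract_twins_closed: "u \<in> carrier M \<Longrightarrow> \<phi> u \<in> carrier G"
  by auto

lemma adjoin_twins_l_one: "u \<in> carrier M \<Longrightarrow> \<one>\<^bsub>M\<^esub> \<otimes>\<^bsub>M\<^esub> u = u"
  and adjoin_twins_r_one: "u \<in> carrier M \<Longrightarrow> u \<otimes>\<^bsub>M\<^esub> \<one>\<^bsub>M\<^esub> = u"
  by (auto simp: mult_adjoin_twins)

lemma adjoin_twins_closed: "u \<in> carrier M \<Longrightarrow> v \<in> carrier M \<Longrightarrow> u \<otimes>\<^bsub>M\<^esub> v \<in> carrier M"
  by (auto simp: mult_adjoin_twins)

lemma retract_twins_mult:
  assumes "u \<in> carrier M" "v \<in> carrier M"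
  shows "\<phi> (u \<otimes>\<^bsub>M\<^esub> v) = \<phi> u \<otimes> \<phi> v"
  using assms by (auto simp: mult_adjoin_twins m_assoc)

lemma retract_twins_eq_one:
  assumes "u \<in> carrier M" "\<phi> u = \<one>"
  shows "u = \<one>\<^bsub>M\<^esub>"
proof -
  have "deg (\<phi> u) = 0"
    using assms by simp
  then show ?thesis
    using assms(1) by (auto simp: deg_0_imp_one)
qed

lemma adjoin_twins_mult_eq_one:
  assumes "u \<in> carrier M" "v \<in> carrier M" "u \<otimes>\<^bsub>M\<^esub> v = \<one>\<^bsub>M\<^esub>"
  shows "v = \<one>\<^bsub>M\<^esub>"
proof -
  have "\<phi> u \<otimes> \<phi> v = \<one>"
    using assms retract_twins_mult[of u v] by simp
  then have "\<phi> v = \<one>"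
    using assms(1,2) mult_eq_one_imp_right_one retract_twins_closed by blast
  with assms(2) show ?thesis
    by (rule retract_twins_eq_one)
qed

lemma adjoin_twins_assoc:
  assumes "u \<in> carrier M" "v \<in> carrier M" "w \<in> carrier M"
  shows "u \<otimes>\<^bsub>M\<^esub> v \<otimes>\<^bsub>M\<^esub> w = u \<otimes>\<^bsub>M\<^esub> (v \<otimes>\<^bsub>M\<^esub> w)"
proof (cases "v = \<one>\<^bsub>M\<^esub> \<or> w = \<one>\<^bsub>M\<^esub>")
  case True
  then show ?thesis
    using assms by (auto simp: mult_adjoin_twins)
next
  case False
  then have "v \<otimes>\<^bsub>M\<^esub> w \<noteq> \<one>\<^bsub>M\<^esub>"
    using assms adjoin_twins_mult_eq_one by blast
  then have "u \<otimes>\<^bsub>M\<^esub> (v \<otimes>\<^bsub>M\<^esub> w) = (\<phi> u \<otimes> (\<phi> v \<otimes> fst w), snd w)"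
    using False by (auto simp: mult_adjoin_twins)
  moreover have "u \<otimes>\<^bsub>M\<^esub> v \<otimes>\<^bsub>M\<^esub> w = (\<phi> u \<otimes> \<phi> v \<otimes> fst w, snd w)"
    using False assms by (simp add: mult_adjoin_twins[of _ _ _ _ w] retract_twins_mult)
  ultimately show ?thesis
    using assms by (auto simp: m_assoc)
qed

lemma adjoin_twins_l_cancel:
  assumes inj: "inj_on ((\<otimes>) (\<phi> u)) (carrier G)"
    and u: "u \<in> carrier M" and v: "v \<in> carrier M" and w: "w \<in> carrier M"
    and eq: "u \<otimes>\<^bsub>M\<^esub> v = u \<otimes>\<^bsub>M\<^esub> w"
  shows "v = w"
proof (cases "v = \<one>\<^bsub>M\<^esub> \<or> w = \<one>\<^bsub>M\<^esub>")
  case True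
  have "\<phi> u \<otimes> \<phi> v = \<phi> u \<otimes> \<phi> w"
    using u v w eq by (metis retract_twins_mult)
  then have "\<phi> v = \<phi> w"
    using inj retract_twins_closed[OF v] retract_twins_closed[OF w] by (simp add: inj_on_eq_iff)
  with True have "\<phi> v = \<one>" "\<phi> w = \<one>"
    by auto
  then show ?thesis
    using retract_twins_eq_one[OF v] retract_twins_eq_one[OF w] by simp
next
  case False
  then have "\<phi> u \<otimes> fst v = \<phi> u \<otimes> fst w" "snd v = snd w"
    using eq by (simp_all add: mult_adjoin_twins)
  moreover have "fst v \<in> carrier G" "fst w \<in> carrier G"
    using v w by auto
  ultimately show ?thesis
    using inj by (simp add: inj_on_eq_iff prod_eq_iff)
qed

lemma level_adjoin_twins_0: "level M (deg \<circ> \<phi>) 0 = level G deg 0 \<times> {None}"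
  by (auto simp: level_def)

lemma level_adjoin_twins_Suc:
  "level M (deg \<circ> \<phi>) (Suc k) = level G deg (Suc k) \<times> {None} \<union> level G deg k \<times> Some ` I"
  by (auto simp: level_def)

lemma graded_monoid_adjoin_twins:
  assumes "finite I"
  shows "graded_monoid M (deg \<circ> \<phi>)"
proof -
  interpret M: monoid M
    by (intro monoidI adjoin_twins_closed adjoin_twins_assoc adjoin_twins_l_one adjoin_twins_r_one)
      simp_all
  show ?thesis
  proof
    show "finite (level M (deg \<circ> \<phi>) k)" for k
      using assms
      by (cases k) (simp_all add: level_adjoin_twins_0 level_adjoin_twins_Suc finite_level)
  qed (auto simp: retract_twins_mult deg_0_imp_one intro: retract_twins_eq_one)
qed

lemma growth_series_adjoin_twins:
  assumes "finite I"
  shows "growth_series M (deg \<circ> \<phi>)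
    = growth_series G deg * (1 + fps_const (of_nat (card I)) * fps_X)"
    (is "_ = ?F * (1 + ?c * fps_X)")
proof (rule fps_ext)
  fix k
  have "?F * (1 + ?c * fps_X) = ?F + ?c * (fps_X * ?F)"
    by (simp add: algebra_simps)
  moreover have "card (level M (deg \<circ> \<phi>) (Suc j))
      = card (level G deg (Suc j)) + card I * card (level G deg j)" for j
    unfolding level_adjoin_twins_Suc using assms
    by (subst card_Un_disjoint) (auto simp: finite_level card_cartesian_product card_image)
  ultimately show "growth_series M (deg \<circ> \<phi>) $ k = (?F * (1 + ?c * fps_X)) $ k"
    by (cases k) (simp_all add: level_adjoin_twins_0 card_cartesian_product)
qed

end

end

lemma (in upho_monoid) upho_monoid_adjoin_twins:
  assumes x: "x \<in> carrier G" "deg x = 1" and "finite I"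
  defines "M \<equiv> adjoin_twins G x I" and "\<phi> \<equiv> retract_twins G x"
  shows "upho_monoid M (deg \<circ> \<phi>)"
proof -
  interpret M: graded_monoid M "deg \<circ> \<phi>"
    unfolding M_def \<phi>_def using assms by (intro graded_monoid_adjoin_twins)
  show ?thesis
  proof
    fix u v w
    assume eq: "u \<otimes>\<^bsub>M\<^esub> v = u \<otimes>\<^bsub>M\<^esub> w" and carr: "v \<in> carrier M" "w \<in> carrier M" "u \<in> carrier M"
    then have "\<phi> u \<in> carrier G"
      unfolding M_def \<phi>_def using x by (intro retract_twins_closed)
    then have "inj_on ((\<otimes>) (\<phi> u)) (carrier G)"
      using l_cancel by (auto intro: inj_onI)
    then show "v = w"
      using x carr eq unfolding M_def \<phi>_def by (metis adjoin_twins_l_cancel)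
  next
    fix u k
    assume u: "u \<in> level M (deg \<circ> \<phi>) (Suc k)"
    obtain m i where mi: "u = (m, i)" "m \<in> carrier G"
      using u by (auto simp: M_def level_def)
    show "\<exists>v\<in>level M (deg \<circ> \<phi>) k. \<exists>w\<in>level M (deg \<circ> \<phi>) 1. u = v \<otimes>\<^bsub>M\<^esub> w"
    proof (cases i)
      case None
      then have "m \<in> level G deg (Suc k)"
        using u mi by (simp add: level_def \<phi>_def)
      then obtain y z where "y \<in> level G deg k" "z \<in> level G deg 1" "m = y \<otimes> z"
        using generated_in_degree_1 by blast
      then show ?thesis
        using mi None
        by (intro bexI[of _ "(y, None)"] bexI[of _ "(z, None)"])
          (auto simp: level_def M_def \<phi>_def mult_adjoin_twins)
    next
      case (Some j)
      then show ?thesis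
        using u mi x
        by (intro bexI[of _ "(m, None)"] bexI[of _ "(\<one>, Some j)"])
          (auto simp: level_def M_def \<phi>_def mult_adjoin_twins)
    qed
  qed
qed


section \<open>Growth series of countable monoids\<close>

lemma mult_image_group:
  assumes "inj_on h (carrier G)" "x \<in> carrier G" "y \<in> carrier G"
  shows "h x \<otimes>\<^bsub>image_group h G\<^esub> h y = h (x \<otimes>\<^bsub>G\<^esub> y)"
  using assms by (simp add: image_group_def)

definition image_deg ::
    "('a \<Rightarrow> 'c) \<Rightarrow> ('a, 'b) monoid_scheme \<Rightarrow> ('a \<Rightarrow> nat) \<Rightarrow> 'c \<Rightarrow> nat" where
  "image_deg h G deg = deg \<circ> inv_into (carrier G) h"

lemma image_deg_image:
  assumes "inj_on h (carrier G)" "x \<in> carrier G"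
  shows "image_deg h G deg (h x) = deg x"
  using assms by (simp add: image_deg_def)

lemma level_image_group:
  assumes "inj_on h (carrier G)"
  shows "level (image_group h G) (image_deg h G deg) k = h ` level G deg k"
  using assms by (auto simp: level_def image_group_carrier image_deg_image)

lemma growth_series_image_group:
  assumes "inj_on h (carrier G)"
  shows "growth_series (image_group h G) (image_deg h G deg) = growth_series G deg"
proof (rule fps_ext)
  fix k
  have "inj_on h (level G deg k)"
    using assms by (rule inj_on_subset) (auto simp: level_def)
  then show "growth_series (image_group h G) (image_deg h G deg) $ k
      = growth_series G deg $ k"
    by (simp add: level_image_group[OF assms] card_image)
qed

lemma (in monoid) monoid_image_group:
  assumes "inj_on h (carrier G)"
  shows "monoid (image_group h G)"
proof -
  have "h \<in> hom G (image_group h G)"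
    using assms by (auto simp: hom_def mult_image_group image_group_carrier)
  from hom_imp_img_monoid[OF this] show ?thesis
    by (simp add: image_group_def)
qed

lemma (in upho_monoid) upho_monoid_image_group:
  assumes inj: "inj_on h (carrier G)"
  shows "upho_monoid (image_group h G) (image_deg h G deg)"
proof -
  interpret K: monoid "image_group h G"
    using inj by (rule monoid_image_group)
  note mult_image = mult_image_group[OF inj]
  show ?thesis
  proof
    fix a b c
    assume "c \<otimes>\<^bsub>image_group h G\<^esub> a = c \<otimes>\<^bsub>image_group h G\<^esub> b" "a \<in> carrier (image_group h G)"
      "b \<in> carrier (image_group h G)" "c \<in> carrier (image_group h G)"
    then show "a = b"
      using inj by (auto simp: image_group_carrier mult_image inj_on_eq_iff dest: l_cancel)
  next
    fix u k
    assume "u \<in> level (image_group h G) (image_deg h G deg) (Suc k)"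
    then obtain x where x: "x \<in> level G deg (Suc k)" and u: "u = h x"
      by (auto simp: level_image_group[OF inj])
    obtain y z where yz: "y \<in> level G deg k" "z \<in> level G deg 1" "x = y \<otimes> z"
      using generated_in_degree_1[OF x] by blast
    then have "h x = h y \<otimes>\<^bsub>image_group h G\<^esub> h z"
      by (simp add: level_def mult_image)
    then show "\<exists>v\<in>level (image_group h G) (image_deg h G deg) k.
        \<exists>w\<in>level (image_group h G) (image_deg h G deg) 1. u = v \<otimes>\<^bsub>image_group h G\<^esub> w"
      unfolding level_image_group[OF inj] u using yz by blast
  qed (use inj in \<open>auto simp: image_group_carrier image_group_one mult_image
      image_deg_image level_image_group finite_level dest: deg_0_imp_one\<close>)
qed

definition nontrivial_growth_series :: "rat fps \<Rightarrow> bool" where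
  "nontrivial_growth_series F \<longleftrightarrow> (\<exists>(G :: nat monoid) deg.
     upho_monoid G deg \<and> level G deg 1 \<noteq> {} \<and> growth_series G deg = F)"

lemma nontrivial_growth_seriesI:
  fixes G :: "('a :: countable) monoid"
  assumes "upho_monoid G deg" "level G deg 1 \<noteq> {}"
  shows "nontrivial_growth_series (growth_series G deg)"
  unfolding nontrivial_growth_series_def
proof (intro exI conjI)
  have inj: "inj_on to_nat (carrier G)"
    using inj_to_nat by (rule inj_on_subset) simp
  let ?G = "image_group to_nat G" and ?deg = "image_deg to_nat G deg"
  show "upho_monoid ?G ?deg"
    using assms(1) inj by (rule upho_monoid.upho_monoid_image_group)
  show "level ?G ?deg 1 \<noteq> {}"
    using assms(2) by (simp add: level_image_group[OF inj])
  show "growth_series ?G ?deg = growth_series G deg"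
    using inj by (rule growth_series_image_group)
qed

lemma nontrivial_growth_series_geometric:
  assumes "b > 0"
  shows "nontrivial_growth_series (inverse (1 - fps_const (of_nat b) * fps_X))"
proof -
  have "[0] \<in> level (free_monoid {..<b}) length 1"
    using assms by (simp add: level_free_monoid)
  then have "nontrivial_growth_series (growth_series (free_monoid {..<b}) length)"
    by (intro nontrivial_growth_seriesI upho_monoid_free_monoid) auto
  then show ?thesis
    by (simp add: growth_series_free_monoid)
qed

lemma nontrivial_growth_series_mult:
  assumes "nontrivial_growth_series F" "nontrivial_growth_series E"
  shows "nontrivial_growth_series (F * E)"
proof -
  obtain G :: "nat monoid" and d x
    where G: "upho_monoid G d" "x \<in> level G d 1" "growth_series G d = F"
    using assms(1) by (auto simp: nontrivial_growth_series_def)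
  obtain H :: "nat monoid" and e
    where H: "upho_monoid H e" "growth_series H e = E"
    using assms(2) by (auto simp: nontrivial_growth_series_def)
  interpret G: upho_monoid G d by fact
  interpret H: upho_monoid H e by fact
  have "(x, \<one>\<^bsub>H\<^esub>) \<in> level (G \<times>\<times> H) (\<lambda>(x, y). d x + e y) 1"
    using G(2) by (simp add: level_def)
  then have "nontrivial_growth_series (growth_series (G \<times>\<times> H) (\<lambda>(x, y). d x + e y))"
    using G(1) H(1) by (intro nontrivial_growth_seriesI upho_monoid_DirProd) auto
  then show ?thesis
    by (simp add: growth_series_DirProd G.graded_monoid_axioms H.graded_monoid_axioms G(3) H(2))
qed

lemma nontrivial_growth_series_prod:
  assumes "finite J" "J \<noteq> {}" "\<And>j. j \<in> J \<Longrightarrow> nontrivial_growth_series (F j)"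
  shows "nontrivial_growth_series (\<Prod>j\<in>J. F j)"
  using assms by (induction rule: finite_ne_induct) (simp_all add: nontrivial_growth_series_mult)

lemma nontrivial_growth_series_mult_linear:
  assumes "nontrivial_growth_series F"
  shows "nontrivial_growth_series (F * (1 + fps_const (of_nat a) * fps_X))"
proof -
  obtain G :: "nat monoid" and deg x
    where G: "upho_monoid G deg" "growth_series G deg = F" and x: "x \<in> carrier G" "deg x = 1"
    using assms by (auto simp: nontrivial_growth_series_def level_def)
  interpret upho_monoid G deg by fact
  have "(x, None) \<in> level (adjoin_twins G x {..<a}) (deg \<circ> retract_twins G x) 1"
    using x by (simp add: level_def)
  then have "nontrivial_growth_series
      (growth_series (adjoin_twins G x {..<a}) (deg \<circ> retract_twins G x))"
    using x by (intro nontrivial_growth_seriesI upho_monoid_adjoin_twins) auto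
  then show ?thesis
    by (simp add: growth_series_adjoin_twins[OF x] G(2))
qed

lemma nontrivial_growth_series_mult_prod_linear:
  assumes "nontrivial_growth_series F" "finite I"
  shows "nontrivial_growth_series (F * (\<Prod>i\<in>I. 1 + fps_const (of_nat (a i)) * fps_X))"
  using assms(2)
proof induction
  case (insert i I)
  then show ?case
    using nontrivial_growth_series_mult_linear[OF insert.IH, of "a i"] by (simp add: mult_ac)
qed (simp add: assms(1))

theorem theorem1p3:
  fixes n m :: nat and a b :: "nat \<Rightarrow> nat"
  assumes "m \<ge> 1"
    and "\<And>i. i \<in> {1..n} \<Longrightarrow> a i > 0"
    and "\<And>j. j \<in> {1..m} \<Longrightarrow> b j > 0"
  shows "\<exists>(P :: nat set) (r :: nat rel) (R :: nat \<Rightarrow> nat set).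
           upho P r R \<and>
           rank_gen_fun R =
             (\<Prod>i=1..n. 1 + fps_const (of_nat (a i)) * fps_X) /
             (\<Prod>j=1..m. 1 - fps_const (of_nat (b j)) * fps_X)"
proof -
  define f :: "nat \<Rightarrow> rat fps" where "f j = 1 - fps_const (of_nat (b j)) * fps_X" for j
  define N D E :: "rat fps" where "N = (\<Prod>i=1..n. 1 + fps_const (of_nat (a i)) * fps_X)"
    and "D = (\<Prod>j=1..m. f j)" and "E = (\<Prod>j=1..m. inverse (f j))"
  have "nontrivial_growth_series (E * N)"
    unfolding E_def N_def f_def using assms
    by (intro nontrivial_growth_series_mult_prod_linear nontrivial_growth_series_prod
        nontrivial_growth_series_geometric) auto
  then obtain G :: "nat monoid" and deg
    where G: "upho_monoid G deg" and EN: "rank_gen_fun (level G deg) = E * N"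
    by (auto simp: nontrivial_growth_series_def growth_series_def)
  have "E * D = 1"
    by (simp add: D_def E_def f_def inverse_mult_eq_1 flip: prod.distrib)
  then have "D \<noteq> 0" and "rank_gen_fun (level G deg) * D = N"
    by (auto simp: EN mult_ac)
  then have "rank_gen_fun (level G deg) = N / D"
    by auto
  then show ?thesis
    using upho_monoid.upho_left_divisibility[OF G] unfolding N_def D_def f_def by blast
qed

end
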